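(* Let $n,s,k \in \mathbb{N}$ with $s \geqslant 2$ and $n \geqslant 100\binom{2s+1}{s}^2 k^2$, and let $\varepsilon = \binom{2s+1}{s}^{-1}$. Then $$(1-\varepsilon)n - 2\binom{2s+1}{s}k \;\leqslant\; m(n,2s+1,s,k) \;\leqslant\; (1-\varepsilon)n + 1.$$
   Context: An $r$-colouring of the complete graph $K_n$ ($n \geqslant 2$) is any function $f: E(K_n) \to [r] = \{1,\dots,r\}$. For a subgraph $H \subseteq K_n$, $c_f(H) = |f(E(H))|$ is the number of distinct colours on edges of $H$. A graph on at least $k+1$ vertices is $k$-connected if deleting any at most $k-1$ vertices leaves a connected graph. $M(f,n,r,s,k)$ is the maximum number of vertices of a $k$-connected subgraph $H \subseteq K_n$ with $c_f(H) \leqslant s$ (taken to be $0$ if no such subgraph exists), and $m(n,r,s,k) = \min_f M(f,n,r,s,k)$, the minimum over all $r$-colourings $f$ of $E(K_n)$. *)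

theory Defs
  imports Complex_Main "HOL-Library.FuncSet" "Graph_Theory.Kuratowski"
begin

text \<open>
  Following the library, an undirected simple graph is a symmetric loop-free digraph
  (\<^locale>\<open>graph\<close>, \<^locale>\<open>pair_graph\<close>). Colourings are defined on the undirected edges,
  i.e. on the two-element sets of end points, so that both arcs of an edge get the same colour.
\<close>

definition edges :: "'a pair_pre_digraph \<Rightarrow> 'a set set" where
  "edges G = (\<lambda>(u, v). {u, v}) ` parcs G"

definition complete_graph :: "nat \<Rightarrow> nat pair_pre_digraph" where
  "complete_graph n =
     \<lparr> pverts = {1..n}, parcs = {(u, v). u \<in> {1..n} \<and> v \<in> {1..n} \<and> u \<noteq> v} \<rparr>"

lemma complete_digraph_complete_graph: "K\<^bsub>n\<^esub> (with_proj (complete_graph n))"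
proof -
  have "{(u, v). u \<in> {1..n} \<and> v \<in> {1..n} \<and> u \<noteq> v}
      = {(u, v). (u, v) \<in> {1..n} \<times> {1..n} \<and> u \<noteq> v}"
    by auto
  then show ?thesis
    unfolding complete_digraph_pair_def by (simp add: complete_graph_def)
qed

lemma edges_complete_graph: "edges (complete_graph n) = {e. e \<subseteq> {1..n} \<and> card e = 2}"
  by (auto simp: edges_def complete_graph_def card_2_iff image_iff)

definition colourings :: "nat \<Rightarrow> nat \<Rightarrow> (nat set \<Rightarrow> nat) set" where
  "colourings n r = edges (complete_graph n) \<rightarrow> {1..r}"

definition num_colours :: "('a set \<Rightarrow> nat) \<Rightarrow> 'a pair_pre_digraph \<Rightarrow> nat" where
  "num_colours f H = card (f ` edges H)"

text \<open>
  ``At most $k - 1$'' is written as \<open>card X < k\<close> to avoid truncated subtraction at \<open>k = 0\<close>.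
  \<open>connected\<close> alone would be ambiguous with topological connectedness.
\<close>

definition k_connected :: "nat \<Rightarrow> ('a, 'b) pre_digraph \<Rightarrow> bool" where
  "k_connected k G \<longleftrightarrow> finite (verts G) \<and> k + 1 \<le> card (verts G) \<and>
     (\<forall>X \<subseteq> verts G. card X < k \<longrightarrow> Digraph_Component.connected (G \<restriction> (verts G - X)))"

definition orders :: "(nat set \<Rightarrow> nat) \<Rightarrow> nat \<Rightarrow> nat \<Rightarrow> nat \<Rightarrow> nat set" where
  "orders f n s k = {card (pverts H) | H :: nat pair_pre_digraph.
     pair_graph H \<and> subgraph (with_proj H) (with_proj (complete_graph n)) \<and>
     k_connected k (with_proj H) \<and> num_colours f H \<le> s}"

text \<open>
  The number of colours \<open>r\<close> is not an argument of \<open>M\<close>: it only restricts the colourings \<open>f\<close> that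
  are considered, and so appears in the definition of \<open>m\<close>.
\<close>

definition M :: "(nat set \<Rightarrow> nat) \<Rightarrow> nat \<Rightarrow> nat \<Rightarrow> nat \<Rightarrow> nat" where
  "M f n s k = Max (insert 0 (orders f n s k))"

lemma finite_orders: "finite (orders f n s k)"
proof (rule finite_subset)
  show "orders f n s k \<subseteq> {..n}"
  proof
    fix x assume "x \<in> orders f n s k"
    then obtain H where "x = card (pverts H)"
        "subgraph (with_proj H) (with_proj (complete_graph n))"
      by (auto simp: orders_def)
    then have "x = card (pverts H)" "pverts H \<subseteq> {1..n}"
      by (auto simp: subgraph_def complete_graph_def)
    then show "x \<in> {..n}" using card_mono[of "{1..n}" "pverts H"] by simp
  qed
qed simp

definition m :: "nat \<Rightarrow> nat \<Rightarrow> nat \<Rightarrow> nat \<Rightarrow> nat" where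
  "m n r s k = Min ((\<lambda>f. M f n s k) ` colourings n r)"

lemma M_le: "M f n s k \<le> n"
  unfolding M_def
proof (rule Max.boundedI)
  show "finite (insert 0 (orders f n s k))" by (simp add: finite_orders)
next
  fix x assume "x \<in> insert 0 (orders f n s k)"
  then consider "x = 0" | H where "x = card (pverts H)"
      "subgraph (with_proj H) (with_proj (complete_graph n))"
    by (auto simp: orders_def)
  then show "x \<le> n"
  proof cases
    case 2
    then have "pverts H \<subseteq> {1..n}" by (auto simp: subgraph_def complete_graph_def)
    then show ?thesis using 2 card_mono[of "{1..n}" "pverts H"] by simp
  qed simp
qed simp

text \<open>The minimum in \<open>m\<close> ranges over a finite nonempty set.\<close>

lemma m_wf:
  assumes "1 \<le> r"
  shows "finite ((\<lambda>f. M f n s k) ` colourings n r)" "(\<lambda>f. M f n s k) ` colourings n r \<noteq> {}"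
proof -
  have "(\<lambda>f. M f n s k) ` colourings n r \<subseteq> {..n}" using M_le by auto
  then show "finite ((\<lambda>f. M f n s k) ` colourings n r)" by (rule finite_subset) simp
  have "(\<lambda>_. 1) \<in> colourings n r" using assms by (auto simp: colourings_def)
  then show "(\<lambda>f. M f n s k) ` colourings n r \<noteq> {}" by blast
qed

end

theory Submission
  imports Defs
begin

text \<open>
  Write \<open>N\<close> for the binomial coefficient \<open>(2 * s + 1) choose s\<close>.

  Upper bound: label the vertices evenly by the \<open>s\<close>-sets of colours and give each edge a colour
  outside the labels of its two ends, which exists as \<open>2 * s < 2 * s + 1\<close>. The vertices labelled
  \<open>S\<close> are isolated in the colours \<open>S\<close>, so a connected subgraph with at most \<open>s\<close> colours misses
  a whole class.

  Lower bound: if there is no large subgraph, then each \<open>s\<close>-set \<open>U\<close> of colours yields a split of the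
  vertices into two large sides \<open>X U\<close> and \<open>V - X U\<close>, where \<open>X U\<close> has more than
  \<open>n / N + 2 * N * k\<close> vertices, each of which sends fewer than \<open>k\<close> edges with colours in \<open>U\<close>
  across. Counting edges, two sets of at least \<open>3 * k\<close> vertices cannot be separated by three splits
  that together use all colours. Consequently any two splits are nearly laminar. If \<open>S\<close> and \<open>T\<close> lie
  on different sides of \<open>E\<close> in the resulting tree of splits, then \<open>S \<inter> T \<subseteq> E\<close>; as \<open>s \<ge> 2\<close>, this
  forces all \<open>s\<close>-sets other than \<open>E\<close> onto the same side of \<open>E\<close>. The tree is a star, so
  the \<open>N\<close> outer sides are nearly disjoint, and together they have more than \<open>n\<close> vertices.
\<close>

section \<open>Set systems\<close>

text \<open>Second Bonferroni inequality with every pairwise intersection bounded by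
  \<open>c\<close>. Doubling avoids halving \<open>card I * (card I - 1)\<close>; a new set brings
  at most \<open>card I\<close> new intersections.\<close>

lemma bonferroni_bound:
  assumes "finite I" and "\<And>i. i \<in> I \<Longrightarrow> finite (Y i)"
    and "\<And>i j. i \<in> I \<Longrightarrow> j \<in> I \<Longrightarrow> i \<noteq> j \<Longrightarrow> card (Y i \<inter> Y j) \<le> c"
  shows "2 * (\<Sum>i\<in>I. card (Y i)) \<le> 2 * card (\<Union>i\<in>I. Y i) + c * (card I * (card I - 1))"
  using assms
proof (induction I rule: finite_induct)
  case empty
  then show ?case by simp
next
  case (insert x I)
  let ?U = "\<Union>i\<in>I. Y i"
  have IH: "2 * (\<Sum>i\<in>I. card (Y i)) \<le> 2 * card ?U + c * (card I * (card I - 1))"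
    using insert by auto
  have "card (Y x \<inter> ?U) = card (\<Union>i\<in>I. Y x \<inter> Y i)" by (rule arg_cong[of _ _ card]) auto
  also have "\<dots> \<le> (\<Sum>i\<in>I. card (Y x \<inter> Y i))" by (rule card_UN_le) (fact insert)
  also have "\<dots> \<le> (\<Sum>i\<in>I. c)" using insert by (intro sum_mono) auto
  finally have overlap: "card (Y x \<inter> ?U) \<le> c * card I" by (simp add: mult.commute)
  have "card (Y x) + card ?U = card (Y x \<union> ?U) + card (Y x \<inter> ?U)"
    using insert by (intro card_Un_Int) auto
  moreover have "c * (Suc (card I) * card I) = c * (card I * (card I - 1)) + 2 * (c * card I)"
    by (cases "card I") (simp_all add: algebra_simps)
  ultimately show ?case using IH overlap insert by simp
qed

definition subsets_of_size :: "nat \<Rightarrow> nat set set" where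
  "subsets_of_size s = {U. U \<subseteq> {1..2 * s + 1} \<and> card U = s}"

lemma finite_subsets_of_size: "finite (subsets_of_size s)"
  by (simp add: subsets_of_size_def)

lemma card_subsets_of_size: "card (subsets_of_size s) = (2 * s + 1) choose s"
  using n_subsets[of "{1..2 * s + 1}" s] by (simp add: subsets_of_size_def)

lemma subsets_of_sizeD:
  assumes "U \<in> subsets_of_size s"
  shows "U \<subseteq> {1..2 * s + 1}" "card U = s" "finite U"
  using assms finite_subset[of U] by (auto simp: subsets_of_size_def)

lemma extend_to_size:
  assumes "A \<subseteq> {1..2 * s + 1}" and "card A \<le> s"
  obtains U where "U \<in> subsets_of_size s" "A \<subseteq> U"
proof -
  obtain U where "A \<subseteq> U" "U \<subseteq> {1..2 * s + 1}" "card U = s"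
    using exists_subset_between[of A s "{1..2 * s + 1}"] assms by auto
  then show thesis using that by (auto simp: subsets_of_size_def)
qed

lemma not_subset_of_size:
  assumes "S \<in> subsets_of_size s" "E \<in> subsets_of_size s" "S \<noteq> E"
  shows "\<not> S \<subseteq> E"
  using assms subsets_of_sizeD card_subset_eq by metis

text \<open>A third set links \<open>S\<close> and \<open>T\<close>: as \<open>s \<ge> 2\<close>,
  some \<open>Z\<close> contains a point of \<open>S - E\<close> and a point of
  \<open>T - E\<close>. Neither \<open>S \<inter> Z\<close> nor \<open>Z \<inter> T\<close> is then
  contained in \<open>E\<close>, so \<open>g\<close> agrees along \<open>S\<close>,
  \<open>Z\<close>, \<open>T\<close>.\<close>

lemma constant_outside_kernel:
  assumes "s \<ge> 2" and E: "E \<in> subsets_of_size s"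
    and g: "\<And>S T. S \<in> subsets_of_size s - {E} \<Longrightarrow> T \<in> subsets_of_size s - {E} \<Longrightarrow>
        g S \<noteq> g T \<Longrightarrow> S \<inter> T \<subseteq> E"
    and S: "S \<in> subsets_of_size s - {E}" and T: "T \<in> subsets_of_size s - {E}"
  shows "g S = g T"
proof -
  obtain x where x: "x \<in> S" "x \<notin> E" using not_subset_of_size[of S s E] S E by auto
  obtain y where y: "y \<in> T" "y \<notin> E" using not_subset_of_size[of T s E] T E by auto
  have "{x, y} \<subseteq> {1..2 * s + 1}" using x y S T subsets_of_sizeD(1) by blast
  moreover have "card {x, y} \<le> s" using assms(1) by (auto intro: order.trans[OF card_insert_le_m1])
  ultimately obtain Z where Z: "Z \<in> subsets_of_size s" "{x, y} \<subseteq> Z" by (rule extend_to_size)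
  have "Z \<in> subsets_of_size s - {E}" using Z x by auto
  then have "g S = g Z" "g Z = g T" using g[of S Z] g[of Z T] S T Z x y by auto
  then show ?thesis by simp
qed

section \<open>Splits with few crossing edges\<close>

text \<open>Abstracts what the failure of the lower bound provides. Degrees across a split are
  bounded only from \<open>X U\<close>, not from its complement. The bound \<open>60 * k\<close> is
  a crude choice above every total of exceptional vertices that occurs, the largest being
  \<open>54 * k\<close>.\<close>

locale sparse_splits =
  fixes V :: "'a set" and f :: "'a set \<Rightarrow> nat" and s k b :: nat and X :: "nat set \<Rightarrow> 'a set"
  assumes finite_V: "finite V" and s_ge: "s \<ge> 2" and k_pos: "k \<ge> 1" and b_ge: "b \<ge> 60 * k"
    and colour: "\<And>x y. x \<in> V \<Longrightarrow> y \<in> V \<Longrightarrow> x \<noteq> y \<Longrightarrow> f {x, y} \<in> {1..2 * s + 1}"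
    and X_subset: "\<And>U. U \<in> subsets_of_size s \<Longrightarrow> X U \<subseteq> V"
    and sparse: "\<And>U x. U \<in> subsets_of_size s \<Longrightarrow> x \<in> X U \<Longrightarrow>
        card {y \<in> V - X U. f {x, y} \<in> U} < k"
    and X_large: "\<And>U. U \<in> subsets_of_size s \<Longrightarrow> b \<le> card (X U)"
    and compl_large: "\<And>U. U \<in> subsets_of_size s \<Longrightarrow> b \<le> card (V - X U)"
begin

text \<open>The Boolean index lets one statement cover both sides of a split; \<open>True\<close>
  marks the side with bounded degrees.\<close>

definition side :: "nat set \<Rightarrow> bool \<Rightarrow> 'a set" where
  "side U a = (if a then X U else V - X U)"

lemma finite_side [simp]: "U \<in> subsets_of_size s \<Longrightarrow> finite (side U a)"
  using X_subset[of U] finite_V finite_subset by (auto simp: side_def)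

lemma side_subset: "U \<in> subsets_of_size s \<Longrightarrow> side U a \<subseteq> V"
  using X_subset[of U] by (auto simp: side_def)

lemma side_large: "U \<in> subsets_of_size s \<Longrightarrow> b \<le> card (side U a)"
  using X_large compl_large by (auto simp: side_def)

lemma card_by_side:
  assumes "U \<in> subsets_of_size s" "A \<subseteq> V"
  shows "card A = card (A \<inter> side U a) + card (A \<inter> side U (\<not> a))"
proof -
  have "A = (A \<inter> side U a) \<union> (A \<inter> side U (\<not> a))" using assms by (auto simp: side_def)
  moreover have "(A \<inter> side U a) \<inter> (A \<inter> side U (\<not> a)) = {}" by (auto simp: side_def)
  ultimately show ?thesis
    using card_Un_disjoint[of "A \<inter> side U a" "A \<inter> side U (\<not> a)"] assms by (metis finite_Int finite_side)
qed

definition separates :: "nat set \<Rightarrow> 'a set \<Rightarrow> 'a set \<Rightarrow> bool" where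
  "separates U A B \<longleftrightarrow> U \<in> subsets_of_size s \<and> (\<exists>a. A \<subseteq> side U a \<and> B \<subseteq> side U (\<not> a))"

lemma separatesI:
  "U \<in> subsets_of_size s \<Longrightarrow> A \<subseteq> side U a \<Longrightarrow> B \<subseteq> side U (\<not> a) \<Longrightarrow> separates U A B"
  by (auto simp: separates_def)

lemma separates_mono: "separates U A B \<Longrightarrow> A' \<subseteq> A \<Longrightarrow> B' \<subseteq> B \<Longrightarrow> separates U A' B'"
  unfolding separates_def by (meson subset_trans)

lemma separatesD:
  assumes "separates U A B"
  shows "A \<inter> B = {}" "A \<subseteq> V" "B \<subseteq> V" "finite A" "finite B"
proof -
  obtain a where a: "U \<in> subsets_of_size s" "A \<subseteq> side U a" "B \<subseteq> side U (\<not> a)"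
    using assms by (auto simp: separates_def)
  show "A \<subseteq> V" "B \<subseteq> V" using a(2,3) side_subset[OF a(1)] by blast+
  then show "finite A" "finite B" using finite_subset[OF _ finite_V] by blast+
  have "side U a \<inter> side U (\<not> a) = {}" by (auto simp: side_def)
  then show "A \<inter> B = {}" using a(2,3) by blast
qed

section \<open>Counting coloured pairs between separated sets\<close>

definition coloured_pairs :: "nat set \<Rightarrow> 'a set \<Rightarrow> 'a set \<Rightarrow> ('a \<times> 'a) set" where
  "coloured_pairs U A B = {(x, y). x \<in> A \<and> y \<in> B \<and> f {x, y} \<in> U}"

lemma card_coloured_pairs_sym: "card (coloured_pairs U A B) = card (coloured_pairs U B A)"
proof -
  have "coloured_pairs U B A = prod.swap ` coloured_pairs U A B"
    by (auto simp: coloured_pairs_def image_iff insert_commute)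
  then show ?thesis by (simp add: card_image)
qed

lemma card_coloured_pairs:
  assumes U: "U \<in> subsets_of_size s" and A: "A \<subseteq> side U True" and B: "B \<subseteq> side U False"
  shows "card (coloured_pairs U A B) \<le> (k - 1) * card A"
proof -
  have fin: "finite A" "finite B" using A B U finite_side finite_subset by metis+
  have "coloured_pairs U A B = (SIGMA x:A. {y \<in> B. f {x, y} \<in> U})"
    by (auto simp: coloured_pairs_def)
  then have "card (coloured_pairs U A B) = (\<Sum>x\<in>A. card {y \<in> B. f {x, y} \<in> U})"
    using fin by simp
  also have "\<dots> \<le> (\<Sum>x\<in>A. k - 1)"
  proof (rule sum_mono)
    fix x assume "x \<in> A"
    then have "card {y \<in> V - X U. f {x, y} \<in> U} < k" using sparse[OF U] A by (auto simp: side_def)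
    moreover have "card {y \<in> B. f {x, y} \<in> U} \<le> card {y \<in> V - X U. f {x, y} \<in> U}"
      using B finite_V by (intro card_mono) (auto simp: side_def)
    ultimately show "card {y \<in> B. f {x, y} \<in> U} \<le> k - 1" by simp
  qed
  finally show ?thesis by (simp add: mult.commute)
qed

text \<open>The degree bound is available for whichever of \<open>A\<close>, \<open>B\<close> lies
  in \<open>X U\<close>. The orientation is not known, hence the disjunction.\<close>

lemma card_coloured_pairs_separates:
  assumes "separates U A B"
  shows "card (coloured_pairs U A B) \<le> (k - 1) * card A \<or>
    card (coloured_pairs U A B) \<le> (k - 1) * card B"
  using assms card_coloured_pairs[of U A B] card_coloured_pairs[of U B A]
    card_coloured_pairs_sym[of U A B]
  unfolding separates_def by (metis (full_types))

lemma card_product_le: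
  assumes "separates U1 A B" and cover: "{1..2 * s + 1} \<subseteq> U1 \<union> U2 \<union> U3"
  shows "card A * card B \<le> card (coloured_pairs U1 A B) + card (coloured_pairs U2 A B)
    + card (coloured_pairs U3 A B)"
proof -
  note D = separatesD[OF assms(1)]
  have fin: "finite (coloured_pairs U A B)" for U
    using D finite_subset[of "coloured_pairs U A B" "A \<times> B"] by (auto simp: coloured_pairs_def)
  have "A \<times> B \<subseteq> coloured_pairs U1 A B \<union> coloured_pairs U2 A B \<union> coloured_pairs U3 A B"
  proof
    fix z assume "z \<in> A \<times> B"
    then obtain x y where z: "z = (x, y)" "x \<in> A" "y \<in> B" by auto
    then have "f {x, y} \<in> {1..2 * s + 1}" using colour D by blast
    then show "z \<in> coloured_pairs U1 A B \<union> coloured_pairs U2 A B \<union> coloured_pairs U3 A B"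
      using z cover unfolding coloured_pairs_def by blast
  qed
  then have "card (A \<times> B) \<le> card (coloured_pairs U1 A B \<union> coloured_pairs U2 A B \<union> coloured_pairs U3 A B)"
    using fin by (intro card_mono) auto
  also have "\<dots> \<le> card (coloured_pairs U1 A B) + card (coloured_pairs U2 A B) + card (coloured_pairs U3 A B)"
    by (meson card_Un_le add_le_mono1 le_trans)
  finally show ?thesis by (simp add: card_cartesian_product)
qed

text \<open>In each colour set, the set without the degree bound has at least \<open>3 * k\<close>
  elements, so at most a fraction \<open>(k - 1) / (3 * k)\<close> of the pairs in
  \<open>A \<times> B\<close> has a colour there. Three such fractions add up to less than all
  pairs.\<close>

lemma three_separations:
  assumes sep: "separates U1 A B" "separates U2 A B" "separates U3 A B"
    and cover: "{1..2 * s + 1} \<subseteq> U1 \<union> U2 \<union> U3"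
  shows "card A < 3 * k \<or> card B < 3 * k"
proof (rule ccontr)
  assume "\<not> ?thesis"
  then have large: "3 * k \<le> card A" "3 * k \<le> card B" by auto
  have bound: "3 * k * card (coloured_pairs U A B) \<le> (k - 1) * (card A * card B)"
    if "separates U A B" for U
  proof -
    have "3 * k * ((k - 1) * card A) \<le> (k - 1) * (card A * card B)"
      "3 * k * ((k - 1) * card B) \<le> (k - 1) * (card A * card B)"
      using mult_right_mono[OF large(2), of "(k - 1) * card A"]
        mult_right_mono[OF large(1), of "(k - 1) * card B"] by (simp_all add: mult_ac)
    then show ?thesis using card_coloured_pairs_separates[OF that]
      by (meson le_trans mult_le_mono2)
  qed
  have "3 * k * (card A * card B) \<le> 3 * k * (card (coloured_pairs U1 A B)
      + card (coloured_pairs U2 A B) + card (coloured_pairs U3 A B))"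
    using card_product_le[OF sep(1) cover] by (rule mult_le_mono2)
  also have "\<dots> \<le> 3 * ((k - 1) * (card A * card B))"
    using bound[OF sep(1)] bound[OF sep(2)] bound[OF sep(3)] by (simp add: algebra_simps)
  finally have "k * (card A * card B) \<le> (k - 1) * (card A * card B)" by simp
  then show False using large k_pos by auto
qed

text \<open>Parts of \<open>A\<close> and \<open>B\<close> on opposite sides of \<open>U\<close>
  cannot both have \<open>3 * k\<close> vertices, by \<open>three_separations\<close>. As each set
  has that many on some side, both lie on a common side up to few exceptions. The returned
  \<open>a\<close> is the side that they nearly avoid.\<close>

lemma unsplit:
  assumes sep: "separates U1 A B" "separates U2 A B" and U: "U \<in> subsets_of_size s"
    and cover: "{1..2 * s + 1} \<subseteq> U1 \<union> U2 \<union> U"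
    and large: "6 * k \<le> card A" "6 * k \<le> card B"
  obtains a where "card (A \<inter> side U a) < 3 * k" "card (B \<inter> side U a) < 3 * k"
proof -
  have *: "card (A \<inter> side U a) < 3 * k \<or> card (B \<inter> side U (\<not> a)) < 3 * k" for a
    using sep U cover by (intro three_separations[of U1 _ _ U2 U])
      (auto intro: separates_mono separatesI)
  have "card A = card (A \<inter> side U True) + card (A \<inter> side U False)"
    "card B = card (B \<inter> side U True) + card (B \<inter> side U False)"
    using card_by_side[OF U, of A True] card_by_side[OF U, of B True] separatesD[OF sep(1)] by auto
  then show thesis using that[of True] that[of False] *[of True] *[of False] large by auto
qed

text \<open>The constant \<open>4 * k\<close> is what the error term of the theorem can absorb, and it is available
  only for the intersection of the two sides \<open>X\<close> on which degrees are bounded.\<close>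

lemma X_Int_X_unsplit:
  assumes S: "S \<in> subsets_of_size s" and T: "T \<in> subsets_of_size s" and U: "U \<in> subsets_of_size s"
    and cover: "{1..2 * s + 1} \<subseteq> S \<union> T \<union> U"
    and large: "4 * k < card (side S True \<inter> side T True)"
  obtains a where "card (side S False \<inter> side T False \<inter> side U a) < 4 * k"
proof -
  let ?P = "side S True \<inter> side T True" and ?W = "side S False \<inter> side T False"
  have "card ?P = card (?P \<inter> side U True) + card (?P \<inter> side U False)"
    using card_by_side[OF U, of ?P True] side_subset[OF S] by auto
  then have "2 * k \<le> card (?P \<inter> side U True) \<or> 2 * k \<le> card (?P \<inter> side U False)"
    using large by linarith
  then obtain a where a: "2 * k \<le> card (?P \<inter> side U a)" by blast
  have "card (?W \<inter> side U (\<not> a)) < 4 * k"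
  proof (rule ccontr)
    let ?A = "?P \<inter> side U a" and ?B = "?W \<inter> side U (\<not> a)"
    assume "\<not> ?thesis"
    then have B: "4 * k \<le> card ?B" by simp
    have sep: "separates S ?A ?B" "separates U ?A ?B"
      using separatesI[OF S, of ?A True ?B] separatesI[OF U, of ?A a ?B] by auto
    \<comment> \<open>\<open>?A\<close> lies in both \<open>X S\<close> and \<open>X T\<close>, so
      \<open>S\<close> and \<open>T\<close> give at most \<open>(k - 1) * card ?A\<close> pairs
      each, together less than half of all pairs because \<open>card ?B\<close> is at least
      \<open>4 * k\<close>. In either orientation, \<open>U\<close> gives less than half as
      well.\<close>
    have "card (coloured_pairs S ?A ?B) \<le> (k - 1) * card ?A"
      "card (coloured_pairs T ?A ?B) \<le> (k - 1) * card ?A"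
      by (rule card_coloured_pairs; use S T in auto)+
    then have main: "card ?A * card ?B \<le> 2 * ((k - 1) * card ?A) + card (coloured_pairs U ?A ?B)"
      using card_product_le[OF sep(1) cover] by linarith
    have AB: "2 * (2 * k * card ?A) \<le> card ?A * card ?B" "2 * (k * card ?B) \<le> card ?A * card ?B"
      using mult_right_mono[OF B, of "card ?A"] mult_right_mono[OF a, of "card ?B"]
      by (simp_all add: mult_ac)
    have "(k - 1) * card ?A < k * card ?A" "(k - 1) * card ?B < k * card ?B"
      using a B k_pos by auto
    then show False using main AB card_coloured_pairs_separates[OF sep(2)] by linarith
  qed
  then show thesis by (rule that)
qed

text \<open>The at most \<open>s\<close> colours missing from \<open>A\<close> extend to an
  \<open>s\<close>-set; this supplies the last split for \<open>three_separations\<close> and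
  \<open>unsplit\<close>.\<close>

lemma covering_set:
  assumes "A \<subseteq> {1..2 * s + 1}" and "s + 1 \<le> card A"
  obtains U where "U \<in> subsets_of_size s" "{1..2 * s + 1} \<subseteq> A \<union> U"
proof -
  have "card ({1..2 * s + 1} - A) = 2 * s + 1 - card A"
    using assms card_Diff_subset[of A "{1..2 * s + 1}"] finite_subset[OF assms(1)] by simp
  then have "card ({1..2 * s + 1} - A) \<le> s" using assms(2) by linarith
  then obtain U where "U \<in> subsets_of_size s" "{1..2 * s + 1} - A \<subseteq> U"
    using extend_to_size[OF Diff_subset] by metis
  then show thesis using that by blast
qed

lemma union_larger:
  assumes "S \<in> subsets_of_size s" "T \<in> subsets_of_size s" "S \<noteq> T"
  shows "s + 1 \<le> card (S \<union> T)"
proof -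
  have "S \<subset> S \<union> T" using not_subset_of_size[of T s S] assms by auto
  then have "card S < card (S \<union> T)" using subsets_of_sizeD assms by (intro psubset_card_mono) auto
  then show ?thesis using subsets_of_sizeD assms by auto
qed

section \<open>Quadrants cut out by two splits\<close>

definition quad :: "nat set \<Rightarrow> nat set \<Rightarrow> bool \<Rightarrow> bool \<Rightarrow> 'a set" where
  "quad S T a c = side S a \<inter> side T c"

lemma quad_sym: "quad S T a c = quad T S c a"
  by (auto simp: quad_def)

lemma quad_subset: "S \<in> subsets_of_size s \<Longrightarrow> quad S T a c \<subseteq> V"
  using side_subset by (auto simp: quad_def)

lemma side_Int_quads:
  assumes "S \<in> subsets_of_size s" "T \<in> subsets_of_size s" "U \<in> subsets_of_size s"
  shows "card (side U e) = card (quad S T True True \<inter> side U e) + card (quad S T True False \<inter> side U e)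
    + card (quad S T False True \<inter> side U e) + card (quad S T False False \<inter> side U e)"
proof -
  have "card (side U e) = card (side U e \<inter> side S True) + card (side U e \<inter> side S False)"
    "card (side U e \<inter> side S a) = card (side U e \<inter> side S a \<inter> side T True)
      + card (side U e \<inter> side S a \<inter> side T False)" for a
    using card_by_side[of S "side U e" True] card_by_side[of T "side U e \<inter> side S a" True]
      side_subset assms by auto
  then show ?thesis by (simp add: quad_def Int_ac)
qed

text \<open>The other two quadrants are large and separated by both \<open>S\<close> and
  \<open>T\<close>, so a split \<open>U\<close> that completes the colours leaves them together. Its
  other side then has fewer than \<open>2 * 3 * k + 2 * 24 * k = 54 * k\<close> vertices.\<close>

lemma opposite_small_quads:
  assumes S: "S \<in> subsets_of_size s" and T: "T \<in> subsets_of_size s" and "S \<noteq> T"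
    and PW: "card (quad S T a c) < 24 * k" "card (quad S T (\<not> a) (\<not> c)) < 24 * k"
  shows False
proof -
  obtain U where U: "U \<in> subsets_of_size s" "{1..2 * s + 1} \<subseteq> S \<union> T \<union> U"
    using covering_set[OF _ union_larger[OF assms(1-3)]] subsets_of_sizeD S T by (metis Un_subset_iff)
  let ?Q = "quad S T a (\<not> c)" and ?R = "quad S T (\<not> a) c"
  have "card (side S a) = card (quad S T a c) + card ?Q"
    "card (side S (\<not> a)) = card ?R + card (quad S T (\<not> a) (\<not> c))"
    using card_by_side[OF T side_subset[OF S], of _ c] by (simp_all add: quad_def)
  then have large: "6 * k \<le> card ?Q" "6 * k \<le> card ?R"
    using side_large[OF S, of a] side_large[OF S, of "\<not> a"] PW b_ge by linarith+
  have "separates S ?Q ?R" "separates T ?Q ?R"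
    using separatesI[OF S, of ?Q a ?R] separatesI[OF T, of ?Q "\<not> c" ?R] by (auto simp: quad_def)
  then obtain e where e: "card (?Q \<inter> side U e) < 3 * k" "card (?R \<inter> side U e) < 3 * k"
    using unsplit[OF _ _ U large] by blast
  have fin: "finite (quad S T x y)" for x y using S by (simp add: quad_def)
  have "card (quad S T a c \<inter> side U e) < 24 * k" "card (quad S T (\<not> a) (\<not> c) \<inter> side U e) < 24 * k"
    using PW card_mono[OF fin, of "quad S T _ _ \<inter> side U e"] by (meson inf_le1 le_less_trans)+
  then have "card (side U e) < 54 * k"
    using e side_Int_quads[OF S T U(1), of e] by (cases a; cases c) auto
  then show False using side_large[OF U(1), of e] b_ge by linarith
qed

text \<open>Two small quadrants within one side would leave that side with fewer than
  \<open>48 * k\<close> vertices; opposite ones are excluded by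
  \<open>opposite_small_quads\<close>.\<close>

lemma unique_small_quad:
  assumes S: "S \<in> subsets_of_size s" and T: "T \<in> subsets_of_size s" and "S \<noteq> T"
    and small: "card (quad S T a c) < 24 * k" "card (quad S T a' c') < 24 * k"
  shows "a' = a \<and> c' = c"
proof -
  have row: "\<not> (card (quad S T x True) < 24 * k \<and> card (quad S T x False) < 24 * k)"
    if "S \<in> subsets_of_size s" "T \<in> subsets_of_size s" for S T x
    using card_by_side[OF that(2) side_subset[OF that(1)], of x True] side_large[OF that(1), of x] b_ge
    by (auto simp: quad_def)
  have col: "\<not> (card (quad S T True y) < 24 * k \<and> card (quad S T False y) < 24 * k)" for y
    using row[OF T S, of y] by (simp add: quad_sym)
  show ?thesis
    using row[OF S T, of a] col[of c] opposite_small_quads[OF S T assms(3), of a c] small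
    by (cases a; cases c; cases a'; cases c') simp_all
qed

text \<open>The two mixed quadrants stay together by \<open>unsplit\<close>, and
  \<open>quad S T False False\<close> is not split by \<open>X_Int_X_unsplit\<close>. If all three
  nearly avoided the same side of \<open>U\<close>, that side would lie mostly in
  \<open>quad S T True True\<close>, and \<open>S\<close>, \<open>T\<close>, \<open>U\<close> would
  separate two large sets.\<close>

lemma diagonals_separated:
  assumes S: "S \<in> subsets_of_size s" and T: "T \<in> subsets_of_size s" and U: "U \<in> subsets_of_size s"
    and cover: "{1..2 * s + 1} \<subseteq> S \<union> T \<union> U"
    and large: "4 * k < card (quad S T True True)" "11 * k \<le> card (quad S T True False)"
      "11 * k \<le> card (quad S T False True)" "11 * k \<le> card (quad S T False False)"
  obtains e where "card (quad S T False False \<inter> side U e) < 4 * k"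
    "card (quad S T True False \<inter> side U (\<not> e)) < 3 * k"
    "card (quad S T False True \<inter> side U (\<not> e)) < 3 * k"
proof -
  let ?P = "quad S T True True" and ?Q = "quad S T True False"
  let ?R = "quad S T False True" and ?W = "quad S T False False"
  have "separates S ?Q ?R" "separates T ?Q ?R"
    using separatesI[OF S, of ?Q True ?R] separatesI[OF T, of ?Q False ?R] by (auto simp: quad_def)
  then obtain a where a: "card (?Q \<inter> side U a) < 3 * k" "card (?R \<inter> side U a) < 3 * k"
    using unsplit[OF _ _ U cover, of ?Q ?R] large by auto
  obtain e where e: "card (?W \<inter> side U e) < 4 * k"
    using X_Int_X_unsplit[OF S T U cover] large(1) by (auto simp: quad_def)
  have "e = (\<not> a)"
  proof (rule ccontr)
    assume "e \<noteq> (\<not> a)"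
    then have [simp]: "e = a" by simp
    have "card (side U a) \<le> card (?P \<inter> side U a) + 10 * k"
      using a e side_Int_quads[OF S T U, of a] by simp
    then have "3 * k \<le> card (?P \<inter> side U a)" using side_large[OF U, of a] b_ge by linarith
    moreover have "3 * k \<le> card (?W \<inter> side U (\<not> a))"
      using card_by_side[OF U quad_subset[OF S], of T False False a] e large(4) by simp
    moreover have "separates S (?P \<inter> side U a) (?W \<inter> side U (\<not> a))"
      "separates T (?P \<inter> side U a) (?W \<inter> side U (\<not> a))"
      "separates U (?P \<inter> side U a) (?W \<inter> side U (\<not> a))"
      using S T U by (auto intro: separatesI[of _ _ True] separatesI[of _ _ a] simp: quad_def)
    ultimately show False using three_separations[OF _ _ _ cover] by fastforce
  qed
  then show thesis using a e that[of e] by simp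
qed

lemma card_remove_side:
  assumes "U \<in> subsets_of_size s" "A \<subseteq> B" "B \<subseteq> V" "card (B \<inter> side U (\<not> a)) < j"
  shows "card A < card (A \<inter> side U a) + j"
proof -
  have "card (A \<inter> side U (\<not> a)) \<le> card (B \<inter> side U (\<not> a))"
    using assms by (intro card_mono) auto
  then show ?thesis using card_by_side[of U A a] assms by auto
qed

text \<open>If no quadrant is small, \<open>diagonals_separated\<close> applies to every
  \<open>U\<close> that completes \<open>S \<union> T\<close>, and auxiliary splits lead to three
  separations of large sets. The size \<open>11 * k\<close> lets a quadrant lose
  \<open>4 * k\<close> twice and keep \<open>3 * k\<close>.\<close>

lemma some_quad_small:
  assumes S: "S \<in> subsets_of_size s" and T: "T \<in> subsets_of_size s" and "S \<noteq> T"
  shows "\<exists>a c. card (quad S T a c) < 11 * k \<and> (a \<and> c \<longrightarrow> card (quad S T a c) \<le> 4 * k)"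
proof (rule ccontr)
  assume "\<not> ?thesis"
  then have neg: "11 * k \<le> card (quad S T a c) \<or> (a \<and> c \<and> 4 * k < card (quad S T a c))" for a c
    by (meson not_le)
  let ?P = "quad S T True True" and ?Q = "quad S T True False"
  let ?R = "quad S T False True" and ?W = "quad S T False False"
  have large: "4 * k < card ?P" "11 * k \<le> card ?Q" "11 * k \<le> card ?R" "11 * k \<le> card ?W"
    using neg[of True True] neg[of True False] neg[of False True] neg[of False False] k_pos by auto
  have ST: "S \<subseteq> {1..2 * s + 1}" "T \<subseteq> {1..2 * s + 1}" "finite S" "finite T"
    using subsets_of_sizeD S T by auto
  obtain y where y: "y \<in> T" "y \<notin> S" using not_subset_of_size[of T s S] assms by auto
  obtain x where x: "x \<in> S" "x \<notin> T" using not_subset_of_size[of S s T] assms by auto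
  show False
  proof (cases "s + 1 < card (S \<union> T)")
    case True
    \<comment> \<open>\<open>U0\<close> contains all colours outside \<open>S\<close> except
      possibly \<open>y\<close>, and \<open>U1\<close> contains \<open>y\<close>, so
      \<open>S\<close>, \<open>U0\<close>, \<open>U1\<close> cover all colours. \<open>U1\<close>
      exists because \<open>S \<union> T\<close> still has \<open>s + 1\<close> colours without
      \<open>y\<close>.\<close>
    have "s + 1 \<le> card (insert y S)" using y ST subsets_of_sizeD[OF S] by simp
    then obtain U0 where U0: "U0 \<in> subsets_of_size s" "{1..2 * s + 1} \<subseteq> insert y S \<union> U0"
      using covering_set[of "insert y S"] y ST by (metis insert_subset subsetD)
    have "s + 1 \<le> card (S \<union> T - {y})" using True y ST by simp
    then obtain U1 where U1: "U1 \<in> subsets_of_size s" "{1..2 * s + 1} \<subseteq> (S \<union> T - {y}) \<union> U1"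
      using covering_set[of "S \<union> T - {y}"] ST by blast
    have cover: "{1..2 * s + 1} \<subseteq> S \<union> T \<union> U0" "{1..2 * s + 1} \<subseteq> S \<union> T \<union> U1"
      "{1..2 * s + 1} \<subseteq> S \<union> U0 \<union> U1"
      using U0(2) U1(2) y ST by blast+
    obtain e where e: "card (?W \<inter> side U0 e) < 4 * k" "card (?Q \<inter> side U0 (\<not> e)) < 3 * k"
      using diagonals_separated[OF S T U0(1) cover(1) large] by metis
    obtain d where d: "card (?W \<inter> side U1 d) < 4 * k" "card (?Q \<inter> side U1 (\<not> d)) < 3 * k"
      using diagonals_separated[OF S T U1(1) cover(2) large] by metis
    \<comment> \<open>\<open>U0\<close> and \<open>U1\<close> both separate \<open>?W\<close> from
      \<open>?Q\<close> up to few vertices. The trimmed sets keep more than \<open>3 * k\<close> and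
      \<open>5 * k\<close> vertices, respectively.\<close>
    let ?W' = "?W \<inter> side U0 (\<not> e) \<inter> side U1 (\<not> d)" and ?Q' = "?Q \<inter> side U0 e \<inter> side U1 d"
    have "card ?W < card (?W \<inter> side U0 (\<not> e)) + 4 * k" "card (?W \<inter> side U0 (\<not> e)) < card ?W' + 4 * k"
      using card_remove_side[OF U0(1) order.refl, of ?W "\<not> e" "4 * k"] e(1)
        card_remove_side[OF U1(1), of "?W \<inter> side U0 (\<not> e)" ?W "\<not> d" "4 * k"] d(1)
        quad_subset[OF S] by auto
    moreover have "card ?Q < card (?Q \<inter> side U0 e) + 3 * k" "card (?Q \<inter> side U0 e) < card ?Q' + 3 * k"
      using card_remove_side[OF U0(1) order.refl, of ?Q e "3 * k"] e(2)
        card_remove_side[OF U1(1), of "?Q \<inter> side U0 e" ?Q d "3 * k"] d(2)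
        quad_subset[OF S] by auto
    moreover have "separates S ?Q' ?W'" "separates U0 ?Q' ?W'" "separates U1 ?Q' ?W'"
      using separatesI[OF S, of ?Q' True ?W'] separatesI[OF U0(1), of ?Q' e ?W']
        separatesI[OF U1(1), of ?Q' d ?W'] by (auto simp: quad_def)
    ultimately show False using three_separations[OF _ _ _ cover(3), of ?Q' ?W'] large by linarith
  next
    case False
    have "S \<union> T = insert x T"
      using x ST False subsets_of_sizeD[OF T] by (intro card_seteq[symmetric]) auto
    have "S \<union> T = insert y S"
      using y ST False subsets_of_sizeD[OF S] by (intro card_seteq[symmetric]) auto
    obtain U0 where U0: "U0 \<in> subsets_of_size s" "{1..2 * s + 1} \<subseteq> S \<union> T \<union> U0"
      using covering_set[OF _ union_larger[OF assms]] ST by (metis Un_subset_iff)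
    \<comment> \<open>\<open>S\<close> and \<open>T\<close> differ only by exchanging
      \<open>x\<close> for \<open>y\<close>. A split \<open>U1\<close> that contains both colours
      makes up for leaving out either \<open>S\<close> or \<open>T\<close> in the cover by
      \<open>S\<close>, \<open>T\<close>, \<open>U0\<close>.\<close>
    have "card {x, y} \<le> s" using s_ge by (simp add: card_insert_if)
    then obtain U1 where U1: "U1 \<in> subsets_of_size s" "{x, y} \<subseteq> U1"
      using extend_to_size[of "{x, y}" s] x y ST by blast
    have cover: "{1..2 * s + 1} \<subseteq> S \<union> U0 \<union> U1" "{1..2 * s + 1} \<subseteq> T \<union> U0 \<union> U1"
      using U0(2) U1(2) \<open>S \<union> T = insert x T\<close> \<open>S \<union> T = insert y S\<close> by blast+
    obtain e where e: "card (?W \<inter> side U0 e) < 4 * k" "card (?Q \<inter> side U0 (\<not> e)) < 3 * k"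
      "card (?R \<inter> side U0 (\<not> e)) < 3 * k"
      using diagonals_separated[OF S T U0 large] by metis
    let ?W' = "?W \<inter> side U0 (\<not> e)" and ?Q' = "?Q \<inter> side U0 e" and ?R' = "?R \<inter> side U0 e"
    have card: "card ?W = card ?W' + card (?W \<inter> side U0 e)"
      "card ?Q = card ?Q' + card (?Q \<inter> side U0 (\<not> e))"
      "card ?R = card ?R' + card (?R \<inter> side U0 (\<not> e))"
      using card_by_side[OF U0(1) quad_subset[OF S], of T _ _ e] by simp_all
    have large': "7 * k \<le> card ?W'" "6 * k \<le> card ?Q'" "6 * k \<le> card ?R'"
      using card e large by linarith+
    have "6 * k \<le> card ?W'" using large'(1) by simp
    have "separates S ?W' ?Q'" "separates U0 ?W' ?Q'"
      using separatesI[OF S, of ?W' False ?Q'] separatesI[OF U0(1), of ?W' "\<not> e" ?Q']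
      by (auto simp: quad_def)
    then obtain d where d: "card (?W' \<inter> side U1 d) < 3 * k" "card (?Q' \<inter> side U1 d) < 3 * k"
      using unsplit[OF _ _ U1(1) cover(1) \<open>6 * k \<le> card ?W'\<close> large'(2)] by blast
    have "separates T ?W' ?R'" "separates U0 ?W' ?R'"
      using separatesI[OF T, of ?W' False ?R'] separatesI[OF U0(1), of ?W' "\<not> e" ?R']
      by (auto simp: quad_def)
    then obtain d' where d': "card (?W' \<inter> side U1 d') < 3 * k" "card (?R' \<inter> side U1 d') < 3 * k"
      using unsplit[OF _ _ U1(1) cover(2) \<open>6 * k \<le> card ?W'\<close> large'(3)] by blast
    have split: "card A = card (A \<inter> side U1 d) + card (A \<inter> side U1 (\<not> d))" if "A \<subseteq> V" for A
      using card_by_side[OF U1(1) that] .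
    have W'V: "?W' \<subseteq> V" "?Q' \<subseteq> V" "?P \<subseteq> V" using quad_subset[OF S] by auto
    have "d' = d"
    proof (rule ccontr)
      assume "d' \<noteq> d"
      then have "d' = (\<not> d)" by simp
      then show False using split[OF W'V(1)] d d' large'(1) by simp
    qed
    have bound: "card (A \<inter> side U1 d) \<le> card (A \<inter> side U0 c \<inter> side U1 d) + card (A \<inter> side U0 (\<not> c))"
      if "A \<subseteq> V" for A c
    proof -
      have "card (A \<inter> side U1 d) = card (A \<inter> side U1 d \<inter> side U0 c) + card (A \<inter> side U1 d \<inter> side U0 (\<not> c))"
        using card_by_side[OF U0(1)] that by (metis le_infI1)
      moreover have "card (A \<inter> side U1 d \<inter> side U0 (\<not> c)) \<le> card (A \<inter> side U0 (\<not> c))"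
        using U0(1) by (intro card_mono) auto
      ultimately show ?thesis by (simp add: Int_ac)
    qed
    \<comment> \<open>Each bound adds the trimmed part on side \<open>d\<close>, below
      \<open>3 * k\<close>, to the vertices lost in trimming, below \<open>4 * k\<close> or
      \<open>3 * k\<close>. Hence side \<open>d\<close> of \<open>U1\<close> lies mostly in
      \<open>?P\<close>.\<close>
    have "card (?W \<inter> side U1 d) < 7 * k" "card (?Q \<inter> side U1 d) < 6 * k" "card (?R \<inter> side U1 d) < 6 * k"
      using bound[of ?W "\<not> e"] bound[of ?Q e] bound[of ?R e] quad_subset[OF S] e d d' \<open>d' = d\<close> by simp_all
    then have P: "6 * k \<le> card (?P \<inter> side U1 d)"
      using side_Int_quads[OF S T U1(1), of d] side_large[OF U1(1), of d] b_ge by linarith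
    \<comment> \<open>\<open>?P1\<close> is opposite to \<open>?W'\<close> in \<open>S\<close>,
      \<open>T\<close>, \<open>U0\<close>, which makes it small. The rest \<open>?P2\<close> is
      opposite to most of \<open>?Q'\<close> in \<open>T\<close>, \<open>U0\<close>,
      \<open>U1\<close>, which is impossible if it is large.\<close>
    let ?P1 = "?P \<inter> side U1 d \<inter> side U0 e" and ?P2 = "?P \<inter> side U1 d \<inter> side U0 (\<not> e)"
    have "separates S ?P1 ?W'" "separates T ?P1 ?W'" "separates U0 ?P1 ?W'"
      using separatesI[OF S, of ?P1 True ?W'] separatesI[OF T, of ?P1 True ?W']
        separatesI[OF U0(1), of ?P1 e ?W'] by (auto simp: quad_def)
    then have "card ?P1 < 3 * k"
      using three_separations[OF _ _ _ U0(2), of ?P1 ?W'] large'(1) by linarith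
    moreover have "card (?P \<inter> side U1 d) = card ?P1 + card ?P2"
      using card_by_side[OF U0(1)] W'V(3) by (metis le_infI1)
    ultimately have "3 * k \<le> card ?P2" using P by linarith
    moreover have "3 * k \<le> card (?Q' \<inter> side U1 (\<not> d))" using split[OF W'V(2)] d large'(2) by linarith
    moreover have "separates T ?P2 (?Q' \<inter> side U1 (\<not> d))" "separates U0 ?P2 (?Q' \<inter> side U1 (\<not> d))"
      "separates U1 ?P2 (?Q' \<inter> side U1 (\<not> d))"
      using separatesI[OF T, of ?P2 True "?Q' \<inter> side U1 (\<not> d)"]
        separatesI[OF U0(1), of ?P2 "\<not> e" "?Q' \<inter> side U1 (\<not> d)"]
        separatesI[OF U1(1), of ?P2 d "?Q' \<inter> side U1 (\<not> d)"] by (auto simp: quad_def)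
    ultimately show False using three_separations[OF _ _ _ cover(2)] by (meson not_less)
  qed
qed

text \<open>Otherwise the splits at \<open>S\<close>, \<open>E\<close>, \<open>T\<close> are nested, and some \<open>U\<close> that contains the colours
  outside \<open>E \<union> (S \<inter> T)\<close> is not split at all.\<close>

lemma small_quads_on_different_sides:
  assumes E: "E \<in> subsets_of_size s" and S: "S \<in> subsets_of_size s" and T: "T \<in> subsets_of_size s"
    and "S \<noteq> E" "T \<noteq> E"
    and small: "card (quad S E a e) < 11 * k" "card (quad T E c (\<not> e)) < 11 * k"
  shows "S \<inter> T \<subseteq> E"
proof (rule ccontr)
  assume "\<not> S \<inter> T \<subseteq> E"
  then have "E \<subset> E \<union> (S \<inter> T)" by blast
  then have "card E < card (E \<union> (S \<inter> T))"
    using subsets_of_sizeD(3) E S by (intro psubset_card_mono) auto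
  then obtain U where U: "U \<in> subsets_of_size s" "{1..2 * s + 1} \<subseteq> E \<union> (S \<inter> T) \<union> U"
    using covering_set[of "E \<union> (S \<inter> T)"] subsets_of_sizeD[OF E] subsets_of_sizeD[OF S]
    by (metis Suc_eq_plus1 Suc_leI Un_least le_infI1)
  then have cover: "{1..2 * s + 1} \<subseteq> S \<union> E \<union> U" "{1..2 * s + 1} \<subseteq> T \<union> E \<union> U" by blast+
  \<comment> \<open>Up to the small quadrants, side \<open>a\<close> of \<open>S\<close> lies in
    side \<open>\<not> e\<close> of \<open>E\<close>, and side \<open>c\<close> of \<open>T\<close>
    in side \<open>e\<close>. The nested splits \<open>S\<close>, \<open>E\<close>, \<open>T\<close>
    thus cut \<open>V\<close> into consecutive pieces \<open>?P\<close>, \<open>?Q1\<close>,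
    \<open>?Q2\<close>, \<open>?W\<close>.\<close>
  let ?P = "quad S E a (\<not> e) \<inter> side T (\<not> c)" and ?W = "quad T E c e \<inter> side S (\<not> a)"
  let ?Q1 = "quad S E (\<not> a) (\<not> e) \<inter> side T (\<not> c)" and ?Q2 = "quad T E (\<not> c) e \<inter> side S (\<not> a)"
  have inE: "quad S E x y \<subseteq> side E y" "quad T E x y \<subseteq> side E y" for x y by (auto simp: quad_def)
  have TE: "side E (\<not> e) \<inter> side T c = quad T E c (\<not> e)" "side E e \<inter> side S a = quad S E a e"
    by (auto simp: quad_def)
  have big: "24 * k \<le> card (quad S E (\<not> a) (\<not> e))" "24 * k \<le> card (quad T E (\<not> c) e)"
    using unique_small_quad[OF S E \<open>S \<noteq> E\<close>, of a e "\<not> a" "\<not> e"]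
      unique_small_quad[OF T E \<open>T \<noteq> E\<close>, of c "\<not> e" "\<not> c" e] small by linarith+
  have "card (side S a) = card (quad S E a e) + card (quad S E a (\<not> e))"
    "card (side T c) = card (quad T E c e) + card (quad T E c (\<not> e))"
    using card_by_side[OF E side_subset] S T by (simp_all add: quad_def)
  then have big': "24 * k \<le> card (quad S E a (\<not> e))" "24 * k \<le> card (quad T E c e)"
    using side_large[OF S, of a] side_large[OF T, of c] small b_ge by linarith+
  have shrink: "card A < card (A \<inter> side T (\<not> c)) + 11 * k" if "A \<subseteq> side E (\<not> e)" for A
    using card_remove_side[OF T that side_subset[OF E], of "\<not> c"] TE small by simp
  have shrink': "card A < card (A \<inter> side S (\<not> a)) + 11 * k" if "A \<subseteq> side E e" for A
    using card_remove_side[OF S that side_subset[OF E], of "\<not> a"] TE small by simp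
  have large: "6 * k \<le> card ?P" "6 * k \<le> card ?W" "6 * k \<le> card ?Q1" "6 * k \<le> card ?Q2"
    using big big' shrink[OF inE(1)[of a]] shrink[OF inE(1)[of "\<not> a"]]
      shrink'[OF inE(2)[of c]] shrink'[OF inE(2)[of "\<not> c"]] by linarith+
  have PW: "separates S ?P ?W" "separates E ?P ?W" and PQ: "separates S ?P ?Q2" "separates E ?P ?Q2"
    and QW: "separates T ?Q1 ?W" "separates E ?Q1 ?W"
    using separatesI[OF S, of ?P a ?W] separatesI[OF E, of ?P "\<not> e" ?W]
      separatesI[OF S, of ?P a ?Q2] separatesI[OF E, of ?P "\<not> e" ?Q2]
      separatesI[OF T, of ?Q1 "\<not> c" ?W] separatesI[OF E, of ?Q1 "\<not> e" ?W] by (auto simp: quad_def)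
  obtain d where d: "card (?P \<inter> side U d) < 3 * k" "card (?W \<inter> side U d) < 3 * k"
    using unsplit[OF PW U(1) cover(1) large(1,2)] .
  obtain d' where d': "card (?P \<inter> side U d') < 3 * k" "card (?Q2 \<inter> side U d') < 3 * k"
    using unsplit[OF PQ U(1) cover(1) large(1,4)] .
  obtain d'' where d'': "card (?Q1 \<inter> side U d'') < 3 * k" "card (?W \<inter> side U d'') < 3 * k"
    using unsplit[OF QW U(1) cover(2) large(3,2)] .
  have one_side: "y = x"
    if "A \<subseteq> V" "6 * k \<le> card A" "card (A \<inter> side U x) < 3 * k" "card (A \<inter> side U y) < 3 * k" for A x y
  proof (rule ccontr)
    assume "y \<noteq> x"
    then have "y = (\<not> x)" by simp
    then show False using card_by_side[OF U(1) that(1), of x] that by simp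
  qed
  \<comment> \<open>The three applications of \<open>unsplit\<close> share \<open>?P\<close> or
    \<open>?W\<close>, so all four pieces nearly avoid the same side of \<open>U\<close>. That side
    would have fewer than \<open>4 * 3 * k + 2 * 11 * k = 34 * k\<close> vertices.\<close>
  have "d' = d" "d'' = d"
    using one_side[of ?P d d'] one_side[of ?W d d''] separatesD[OF PW(1)] large d d' d'' by blast+
  have "side U d \<subseteq> (?P \<inter> side U d) \<union> (?W \<inter> side U d) \<union> (?Q1 \<inter> side U d) \<union> (?Q2 \<inter> side U d)
      \<union> quad S E a e \<union> quad T E c (\<not> e)"
  proof
    fix v assume v: "v \<in> side U d"
    have in_side: "v \<in> side Z x \<or> v \<in> side Z (\<not> x)" for Z x
      using v side_subset[OF U(1)] by (auto simp: side_def)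
    show "v \<in> (?P \<inter> side U d) \<union> (?W \<inter> side U d) \<union> (?Q1 \<inter> side U d) \<union> (?Q2 \<inter> side U d)
      \<union> quad S E a e \<union> quad T E c (\<not> e)"
      using v in_side[of S a] in_side[of T c] in_side[of E e] unfolding quad_def by blast
  qed
  then have "card (side U d) \<le> card ((?P \<inter> side U d) \<union> (?W \<inter> side U d) \<union> (?Q1 \<inter> side U d)
      \<union> (?Q2 \<inter> side U d) \<union> quad S E a e \<union> quad T E c (\<not> e))"
    using U S T by (intro card_mono) (auto simp: quad_def)
  also have "\<dots> \<le> card (?P \<inter> side U d) + card (?W \<inter> side U d) + card (?Q1 \<inter> side U d)
      + card (?Q2 \<inter> side U d) + card (quad S E a e) + card (quad T E c (\<not> e))"
    by (meson card_Un_le add_le_mono1 le_trans)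
  finally show False
    using d d' d'' \<open>d' = d\<close> \<open>d'' = d\<close> small side_large[OF U(1), of d] b_ge by simp
qed

section \<open>The star of outer sides\<close>

text \<open>\<open>g S\<close> is a side of \<open>E\<close> that contains a small quadrant with
  \<open>S\<close>. Different values force \<open>S \<inter> T \<subseteq> E\<close>, so
  \<open>constant_outside_kernel\<close> makes \<open>g\<close> constant. The common value is the
  outer side of \<open>E\<close>: every other split leaves it almost uncut.\<close>

lemma common_outer_side:
  assumes E: "E \<in> subsets_of_size s"
  shows "\<exists>e. \<forall>S \<in> subsets_of_size s - {E}. \<exists>a. card (quad S E a e) < 11 * k"
proof -
  define g where "g S = (SOME e. \<exists>a. card (quad S E a e) < 11 * k)" for S
  have g: "\<exists>a. card (quad S E a (g S)) < 11 * k" if "S \<in> subsets_of_size s - {E}" for S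
    unfolding g_def by (rule someI_ex) (use some_quad_small[of S E] that E in blast)
  have "S \<inter> T \<subseteq> E"
    if "S \<in> subsets_of_size s - {E}" "T \<in> subsets_of_size s - {E}" "g S \<noteq> g T" for S T
  proof -
    have "g T = (\<not> g S)" using that(3) by auto
    then show ?thesis
      using g[OF that(1)] g[OF that(2)] small_quads_on_different_sides[OF E, of S T] that by auto
  qed
  then have const: "g S = g T" if "S \<in> subsets_of_size s - {E}" "T \<in> subsets_of_size s - {E}" for S T
    using constant_outside_kernel[OF s_ge E, of g S T] that by blast
  show ?thesis
  proof (cases "subsets_of_size s - {E} = {}")
    case False
    then obtain S0 where "S0 \<in> subsets_of_size s - {E}" by blast
    then have "\<exists>a. card (quad S E a (g S0)) < 11 * k" if "S \<in> subsets_of_size s - {E}" for S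
      using g[OF that] const[OF that] by simp
    then show ?thesis by blast
  qed auto
qed

text \<open>\<open>y\<close> picks the outer side of each split. The small quadrants found in the
  outer side of \<open>S\<close> and in that of \<open>T\<close> coincide by
  \<open>unique_small_quad\<close>, hence equal the intersection of the two. By uniqueness, the
  sharper bound of \<open>some_quad_small\<close> also concerns this quadrant.\<close>

lemma nearly_disjoint_sides:
  obtains y where "\<And>S T. S \<in> subsets_of_size s \<Longrightarrow> T \<in> subsets_of_size s \<Longrightarrow> S \<noteq> T \<Longrightarrow>
    card (side S (y S) \<inter> side T (y T)) < 11 * k \<and>
    (y S \<and> y T \<longrightarrow> card (side S (y S) \<inter> side T (y T)) \<le> 4 * k)"
proof -
  obtain y where y: "\<And>E S. E \<in> subsets_of_size s \<Longrightarrow> S \<in> subsets_of_size s - {E} \<Longrightarrow>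
      \<exists>a. card (quad S E a (y E)) < 11 * k"
    using common_outer_side by metis
  show thesis
  proof (rule that[of y])
    fix S T assume ST: "S \<in> subsets_of_size s" "T \<in> subsets_of_size s" "S \<noteq> T"
    obtain a where a: "card (quad S T a (y T)) < 11 * k" using y[of T S] ST by auto
    obtain c where c: "card (quad S T (y S) c) < 11 * k"
      using y[of S T] ST quad_sym[of T S] by auto
    obtain a' c' where s: "card (quad S T a' c') < 11 * k" "a' \<and> c' \<longrightarrow> card (quad S T a' c') \<le> 4 * k"
      using some_quad_small[OF ST] by blast
    have "a = y S" "a' = y S" "c' = y T"
      using unique_small_quad[OF ST, of a "y T" "y S" c] unique_small_quad[OF ST, of a "y T" a' c']
        a c s(1) by auto
    then show "card (side S (y S) \<inter> side T (y T)) < 11 * k \<and>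
        (y S \<and> y T \<longrightarrow> card (side S (y S) \<inter> side T (y T)) \<le> 4 * k)"
      using s by (simp add: quad_def)
  qed
qed

end

section \<open>Connectivity and colour classes\<close>

text \<open>A walk in the symmetric closure that starts in \<open>A\<close> and uses no crossing arc
  never leaves \<open>A\<close>.\<close>

lemma connected_crossing:
  assumes "Digraph_Component.connected G" "A \<subseteq> verts G" "a \<in> A" "b \<in> verts G - A"
  obtains e where "e \<in> arcs G" "tail G e \<in> A \<and> head G e \<notin> A \<or> head G e \<in> A \<and> tail G e \<notin> A"
proof (rule ccontr)
  assume no: "\<not> thesis"
  have "a \<rightarrow>\<^sup>*\<^bsub>with_proj (mk_symmetric G)\<^esub> b"
    using assms unfolding Digraph_Component.connected_def by (auto simp: strongly_connected_def)
  then have "(a, b) \<in> rtrancl_on (verts G) (parcs (mk_symmetric G))"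
    by (simp add: reachable_def)
  then have "b \<in> A"
  proof (induction rule: rtrancl_on_induct)
    case (step y z)
    then show ?case using no that by (fastforce simp: parcs_mk_symmetric)
  qed (rule assms(3))
  then show False using assms by simp
qed

text \<open>The cut is the set of vertices reachable, in the symmetric closure, from some
  \<open>u\<close> that does not reach every vertex.\<close>

lemma not_connected_cut:
  assumes "\<not> Digraph_Component.connected G" "verts G \<noteq> {}"
  obtains A where "A \<subseteq> verts G" "A \<noteq> {}" "A \<noteq> verts G"
    "\<And>e. e \<in> arcs G \<Longrightarrow> tail G e \<in> verts G \<Longrightarrow> head G e \<in> verts G \<Longrightarrow>
      tail G e \<in> A \<longleftrightarrow> head G e \<in> A"
proof -
  let ?R = "rtrancl_on (verts G) (parcs (mk_symmetric G))"
  obtain u v where uv: "u \<in> verts G" "v \<in> verts G" "(u, v) \<notin> ?R"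
    using assms unfolding Digraph_Component.connected_def by (auto simp: strongly_connected_def reachable_def)
  show thesis
  proof (rule that[of "{x. (u, x) \<in> ?R}"])
    show "{x. (u, x) \<in> ?R} \<subseteq> verts G" using in_rtrancl_on_in_F by fast
    show "{x. (u, x) \<in> ?R} \<noteq> {}" using uv(1) by blast
    show "{x. (u, x) \<in> ?R} \<noteq> verts G" using uv by blast
    fix e assume e: "e \<in> arcs G" "tail G e \<in> verts G" "head G e \<in> verts G"
    then have "(tail G e, head G e) \<in> parcs (mk_symmetric G)" "(head G e, tail G e) \<in> parcs (mk_symmetric G)"
      by (auto simp: parcs_mk_symmetric)
    then show "tail G e \<in> {x. (u, x) \<in> ?R} \<longleftrightarrow> head G e \<in> {x. (u, x) \<in> ?R}"
      using e rtrancl_on_into_rtrancl_on by fast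
  qed
qed

section \<open>Subgraphs spanned by a set of colours\<close>

definition colour_graph :: "(nat set \<Rightarrow> nat) \<Rightarrow> nat set \<Rightarrow> nat set \<Rightarrow> nat pair_pre_digraph" where
  "colour_graph f U Z = \<lparr>pverts = Z, parcs = {(u, v). u \<in> Z \<and> v \<in> Z \<and> u \<noteq> v \<and> f {u, v} \<in> U}\<rparr>"

lemma colour_graph_simps [simp]:
  "pverts (colour_graph f U Z) = Z"
  "(u, v) \<in> parcs (colour_graph f U Z) \<longleftrightarrow> u \<in> Z \<and> v \<in> Z \<and> u \<noteq> v \<and> f {u, v} \<in> U"
  by (simp_all add: colour_graph_def)

lemma colour_graph_order:
  assumes "Z \<subseteq> {1..n}" "U \<in> subsets_of_size s" "k_connected k (with_proj (colour_graph f U Z))"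
  shows "card Z \<in> orders f n s k"
proof -
  let ?H = "colour_graph f U Z"
  have fin: "finite Z" using assms(1) finite_subset by blast
  have "parcs ?H \<subseteq> Z \<times> Z" by (auto simp: colour_graph_def)
  then have "finite (parcs ?H)" using fin finite_subset by blast
  then have "pair_graph ?H"
    using fin by unfold_locales (auto simp: colour_graph_def symmetric_def insert_commute intro!: symI)
  moreover have "subgraph (with_proj ?H) (with_proj (complete_graph n))"
    using assms(1) by (auto simp: subgraph_def complete_graph_def colour_graph_def compatible_def wf_digraph_def)
  moreover have "f ` edges ?H \<subseteq> U" by (auto simp: edges_def colour_graph_def)
  then have "num_colours f ?H \<le> s"
    using card_mono[of U] subsets_of_sizeD[OF assms(2)] by (auto simp: num_colours_def)
  ultimately show ?thesis using assms(3) by (auto simp: orders_def intro!: exI[of _ ?H])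
qed

text \<open>Deleting fewer than \<open>k\<close> vertices \<open>C\<close> leaves two parts without
  edges coloured in \<open>U\<close> between them, so such edges leaving a part end in
  \<open>C\<close>. The smaller part serves as \<open>A\<close>.\<close>

lemma cut_of_not_k_connected:
  assumes fin: "finite Z" and card: "k + 1 \<le> card Z"
    and not_conn: "\<not> k_connected k (with_proj (colour_graph f U Z))"
  obtains A where "A \<subseteq> Z" "A \<noteq> {}" "2 * card A \<le> card Z"
    "\<And>x. x \<in> A \<Longrightarrow> card {y \<in> Z - A. f {x, y} \<in> U} < k"
proof -
  let ?H = "with_proj (colour_graph f U Z)"
  obtain C where C: "C \<subseteq> Z" "card C < k" "\<not> Digraph_Component.connected (?H \<restriction> (Z - C))"
    using assms by (auto simp: k_connected_def)
  have "Z - C \<noteq> {}" using C card card_mono[of C Z] finite_subset[OF C(1) fin] by auto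
  then obtain A where A: "A \<subseteq> Z - C" "A \<noteq> {}" "A \<noteq> Z - C"
    and cut: "\<And>e. e \<in> arcs (?H \<restriction> (Z - C)) \<Longrightarrow> fst e \<in> Z - C \<Longrightarrow> snd e \<in> Z - C \<Longrightarrow>
      fst e \<in> A \<longleftrightarrow> snd e \<in> A"
    using not_connected_cut[OF C(3)] by (auto simp: induce_subgraph_def)
  have sep: "f {x, y} \<notin> U" if "x \<in> A" "y \<in> Z - C - A" for x y
  proof
    assume "f {x, y} \<in> U"
    then have "(x, y) \<in> arcs (?H \<restriction> (Z - C))"
      using that A(1) by (auto simp: induce_subgraph_def)
    then show False using cut[of "(x, y)"] that A(1) by auto
  qed
  have sparse: "card {y \<in> Z - D. f {x, y} \<in> U} < k"
    if "x \<in> D" "D \<in> {A, Z - C - A}" for x D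
  proof -
    have "{y \<in> Z - D. f {x, y} \<in> U} \<subseteq> C"
      using that sep[of x] sep[of _ x] by (auto simp: insert_commute)
    then show ?thesis using C(2) card_mono[OF finite_subset[OF C(1) fin]] by (meson le_less_trans)
  qed
  have "card A + card (Z - C - A) = card (Z - C)"
    using A(1) fin by (metis card_Diff_subset card_mono finite_Diff finite_subset le_add_diff_inverse)
  also have "\<dots> \<le> card Z" using fin by (intro card_mono) auto
  finally have "2 * card A \<le> card Z \<or> 2 * card (Z - C - A) \<le> card Z" by linarith
  then show thesis
  proof
    assume "2 * card A \<le> card Z"
    then show thesis using that[of A] A sparse[of _ A] by blast
  next
    assume "2 * card (Z - C - A) \<le> card Z"
    then show thesis using that[of "Z - C - A"] A sparse[of _ "Z - C - A"] by blast
  qed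
qed

text \<open>Take a smallest \<open>Z\<close> with at least \<open>L\<close> vertices that receives
  fewer than \<open>k\<close> edges coloured in \<open>U\<close> from each outside vertex. Cutting
  off a sparse part \<open>A\<close> keeps the degree condition, so minimality brings the size below
  \<open>L\<close>. As \<open>A\<close> is at most half of \<open>Z\<close>, at least
  \<open>L / 2\<close> vertices remain.\<close>

lemma sparse_split_exists:
  assumes fin: "finite V" and L: "k + 1 \<le> L" "L \<le> card V"
    and none: "\<And>Z. Z \<subseteq> V \<Longrightarrow> L \<le> card Z \<Longrightarrow> \<not> k_connected k (with_proj (colour_graph f U Z))"
  obtains X where "X \<subseteq> V" "card (V - X) < L" "L \<le> 2 * card (V - X)"
    "\<And>x. x \<in> X \<Longrightarrow> card {y \<in> V - X. f {x, y} \<in> U} < k"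
proof -
  define good where "good Z \<longleftrightarrow> Z \<subseteq> V \<and> L \<le> card Z \<and>
    (\<forall>x\<in>V - Z. card {y \<in> Z. f {x, y} \<in> U} < k)" for Z
  have "good V" using L by (simp add: good_def)
  then obtain Z where "good Z" and min: "\<And>Z'. good Z' \<Longrightarrow> card Z \<le> card Z'"
    using ex_has_least_nat[of good V card] by auto
  then have Z: "Z \<subseteq> V" "L \<le> card Z" "\<And>x. x \<in> V - Z \<Longrightarrow> card {y \<in> Z. f {x, y} \<in> U} < k"
    by (auto simp: good_def)
  have finZ: "finite Z" using Z(1) fin finite_subset by blast
  have "k + 1 \<le> card Z" using Z(2) L(1) by linarith
  then obtain A where A: "A \<subseteq> Z" "A \<noteq> {}" "2 * card A \<le> card Z"
    "\<And>x. x \<in> A \<Longrightarrow> card {y \<in> Z - A. f {x, y} \<in> U} < k"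
    using cut_of_not_k_connected[OF finZ _ none[OF Z(1,2)]] by blast
  have sparse: "card {y \<in> Z - A. f {x, y} \<in> U} < k" if "x \<in> V - (Z - A)" for x
  proof (cases "x \<in> A")
    case False
    then have "card {y \<in> Z. f {x, y} \<in> U} < k" using Z(3) that by blast
    moreover have "card {y \<in> Z - A. f {x, y} \<in> U} \<le> card {y \<in> Z. f {x, y} \<in> U}"
      using finZ by (intro card_mono) auto
    ultimately show ?thesis by linarith
  qed (rule A(4))
  have "card (Z - A) < card Z" using A finZ by (intro psubset_card_mono) auto
  then have "\<not> good (Z - A)" using min by (meson not_less)
  then have "card (Z - A) < L" using sparse Z(1) by (auto simp: good_def)
  moreover have "card (Z - A) = card Z - card A"
    using A(1) finZ by (simp add: card_Diff_subset finite_subset)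
  moreover have "V - (V - (Z - A)) = Z - A" using Z(1) by blast
  ultimately show thesis using that[of "V - (Z - A)"] sparse A(3) Z(2) by auto
qed

section \<open>The lower bound\<close>

lemma choose_ge_10:
  assumes "s \<ge> 2"
  shows "10 \<le> (2 * s + 1) choose s"
  using assms
proof (induction s rule: dec_induct)
  case base
  show ?case by (simp add: numeral_eq_Suc)
next
  case (step s)
  have "(2 * Suc s + 1) choose Suc s = ((2 * s + 2) choose s) + ((2 * s + 1 choose s) + (2 * s + 1 choose Suc s))"
    by (simp add: numeral_eq_Suc)
  then show ?case using step by linarith
qed

lemma large_order_exists:
  fixes n s k :: nat
  defines "N \<equiv> (2 * s + 1) choose s"
  assumes k: "k \<ge> 1" and s: "s \<ge> 2" and n: "n \<ge> 100 * N\<^sup>2 * k\<^sup>2"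
    and f: "f \<in> colourings n (2 * s + 1)"
  shows "\<exists>t \<in> orders f n s k. (1 - 1 / N) * n - 2 * real N * real k \<le> real t"
proof (rule ccontr)
  assume neg: "\<not> ?thesis"
  \<comment> \<open>With this rounding, a set has at least \<open>L\<close> elements exactly when
    its size reaches the real threshold.\<close>
  define L where "L = nat \<lceil>(1 - 1 / N) * n - 2 * real N * real k\<rceil>"
  define V where "V = {1..n}"
  have N: "10 \<le> N" unfolding N_def using choose_ge_10[OF s] .
  have "real n \<ge> real (100 * N\<^sup>2 * k\<^sup>2)" using n by (simp only: of_nat_le_iff)
  then have n_real: "real n \<ge> 100 * (real N)\<^sup>2 * (real k)\<^sup>2" by simp
  have kk: "real k \<le> (real k)\<^sup>2" using k by (simp add: power2_eq_square)
  have n_ge: "real n \<ge> 100 * (real N)\<^sup>2 * real k"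
    using n_real mult_left_mono[OF kk, of "100 * (real N)\<^sup>2"] by simp
  define q where "q = real n / N"
  have n_N: "q \<ge> 100 * (real N * real k)"
    using n_ge N by (simp add: q_def field_simps power2_eq_square)
  have Nk: "10 * real k \<le> real N * real k" using N by (intro mult_right_mono) auto
  have "10 * real n \<le> real N * real n" using N by (intro mult_right_mono) auto
  then have n_10: "10 * q \<le> real n" using N by (simp add: q_def field_simps)
  have L_le: "real (card Z) < (1 - 1 / N) * n - 2 * real N * real k" if "card Z < L" for Z :: "nat set"
    using that unfolding L_def by linarith
  have L_ge: "(1 - 1 / N) * n - 2 * real N * real k \<le> real t" if "L \<le> t" for t
    using that unfolding L_def by linarith
  have L_eq: "(1 - 1 / real N) * real n - 2 * real N * real k = real n - q - 2 * (real N * real k)"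
    by (simp add: q_def algebra_simps)
  have L_real: "real L \<ge> (22 / 25) * real n" "real L < real n - q - 2 * (real N * real k) + 1"
  proof -
    \<comment> \<open>As \<open>q\<close> is at most \<open>n / 10\<close> and
      \<open>2 * N * k\<close> at most \<open>q / 50\<close>, at least \<open>0.898 * n\<close>
      remains. The value \<open>22 / 25\<close> halves to the bound \<open>11 / 25\<close> for the
      sides \<open>V - X U\<close>.\<close>
    have pos: "real n - q - 2 * (real N * real k) \<ge> (22 / 25) * real n" using n_N n_10 by linarith
    then have "real L = of_int \<lceil>real n - q - 2 * (real N * real k)\<rceil>"
      unfolding L_def L_eq by (simp add: order.trans[OF _ pos])
    then show "real L \<ge> (22 / 25) * real n" "real L < real n - q - 2 * (real N * real k) + 1"
      using pos by linarith+
  qed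
  have k_real: "real k \<ge> 1" using k by simp
  have "real k + 1 \<le> real L" "real L \<le> real n" using L_real n_N n_10 Nk k_real by linarith+
  then have L: "k + 1 \<le> L" "L \<le> card V" by (simp_all add: V_def)
  have "\<exists>X. X \<subseteq> V \<and> card (V - X) < L \<and> L \<le> 2 * card (V - X) \<and>
      (\<forall>x\<in>X. card {y \<in> V - X. f {x, y} \<in> U} < k)" if U: "U \<in> subsets_of_size s" for U
  proof -
    have "\<not> k_connected k (with_proj (colour_graph f U Z))" if "Z \<subseteq> V" "L \<le> card Z" for Z
      using colour_graph_order[OF that(1)[unfolded V_def] U, of k f] neg L_ge[OF that(2)] by blast
    then obtain X where "X \<subseteq> V" "card (V - X) < L" "L \<le> 2 * card (V - X)"
        "\<And>x. x \<in> X \<Longrightarrow> card {y \<in> V - X. f {x, y} \<in> U} < k"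
      using sparse_split_exists[OF _ L, of f U] by (auto simp: V_def)
    then show ?thesis by blast
  qed
  then have "\<forall>U \<in> subsets_of_size s. \<exists>X. X \<subseteq> V \<and> card (V - X) < L \<and> L \<le> 2 * card (V - X) \<and>
      (\<forall>x\<in>X. card {y \<in> V - X. f {x, y} \<in> U} < k)" by blast
  from bchoice[OF this] obtain X where X: "\<And>U. U \<in> subsets_of_size s \<Longrightarrow> X U \<subseteq> V"
    "\<And>U. U \<in> subsets_of_size s \<Longrightarrow> card (V - X U) < L"
    "\<And>U. U \<in> subsets_of_size s \<Longrightarrow> L \<le> 2 * card (V - X U)"
    "\<And>U x. U \<in> subsets_of_size s \<Longrightarrow> x \<in> X U \<Longrightarrow> card {y \<in> V - X U. f {x, y} \<in> U} < k"
    by blast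
  have X_card: "real (card (X U)) > q + 2 * (real N * real k)" if "U \<in> subsets_of_size s" for U
  proof -
    have "card (X U) + card (V - X U) = n"
      using card_Diff_subset[of "X U" V] X(1)[OF that] card_mono[of V "X U"] finite_subset[of "X U" V]
      by (simp add: V_def)
    then have "real (card (X U)) + real (card (V - X U)) = real n" by linarith
    then show ?thesis using L_le[OF X(2)[OF that]] unfolding L_eq by linarith
  qed
  have W_card: "real (card (V - X U)) \<ge> (11 / 25) * n" if "U \<in> subsets_of_size s" for U
    using X(3)[OF that] L_real by linarith
  interpret sparse_splits V f s k "60 * k" X
  proof
    fix x y assume "x \<in> V" "y \<in> V" "x \<noteq> y"
    then have "{x, y} \<in> edges (complete_graph n)"
      by (auto simp: edges_complete_graph V_def)
    then show "f {x, y} \<in> {1..2 * s + 1}" using f by (auto simp: colourings_def)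
  next
    fix U assume U: "U \<in> subsets_of_size s"
    show "60 * k \<le> card (X U)" using X_card[OF U] n_N Nk by linarith
    show "60 * k \<le> card (V - X U)" using W_card[OF U] n_N n_10 Nk by linarith
  qed (use X s k in \<open>auto simp: V_def\<close>)
  let ?I = "subsets_of_size s"
  obtain y where y: "\<And>S T. S \<in> ?I \<Longrightarrow> T \<in> ?I \<Longrightarrow> S \<noteq> T \<Longrightarrow>
    card (side S (y S) \<inter> side T (y T)) < 11 * k \<and>
    (y S \<and> y T \<longrightarrow> card (side S (y S) \<inter> side T (y T)) \<le> 4 * k)"
    using nearly_disjoint_sides by blast
  define Y where "Y U = side U (y U)" for U
  have cI: "card ?I = N" by (simp add: card_subsets_of_size N_def)
  have union: "card (\<Union>U\<in>?I. Y U) \<le> card V"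
    using side_subset by (intro card_mono) (auto simp: V_def Y_def)
  have bound: "2 * (\<Sum>U\<in>?I. card (Y U)) \<le> 2 * n + c * (N * (N - 1))"
    if "\<And>S T. S \<in> ?I \<Longrightarrow> T \<in> ?I \<Longrightarrow> S \<noteq> T \<Longrightarrow> card (Y S \<inter> Y T) \<le> c" for c
  proof -
    have "2 * (\<Sum>U\<in>?I. card (Y U)) \<le> 2 * card (\<Union>U\<in>?I. Y U) + c * (card ?I * (card ?I - 1))"
      by (rule bonferroni_bound) (use that in \<open>auto simp: Y_def finite_subsets_of_size\<close>)
    then show ?thesis using union by (simp add: cI V_def)
  qed
  have real_bound: "2 * (\<Sum>U\<in>?I. real (card (Y U))) \<le> 2 * n + real c * (N * (real N - 1))"
    if "\<And>S T. S \<in> ?I \<Longrightarrow> T \<in> ?I \<Longrightarrow> S \<noteq> T \<Longrightarrow> card (Y S \<inter> Y T) \<le> c" for c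
  proof -
    have "real (2 * (\<Sum>U\<in>?I. card (Y U))) \<le> real (2 * n + c * (N * (N - 1)))"
      unfolding of_nat_le_iff by (rule bound) (rule that)
    then show ?thesis using N by (simp add: of_nat_diff)
  qed
  have N0: "real N > 0" using N by simp
  show False
  proof (cases "\<forall>U\<in>?I. y U")
    case True
    \<comment> \<open>All outer sides are of the form \<open>X U\<close>, so overlaps are at most
      \<open>4 * k\<close>. The excess \<open>2 * N * k\<close> of each side adds up to
      \<open>2 * N * N * k\<close>, while overlaps account for at most
      \<open>2 * N * (N - 1) * k\<close>.\<close>
    have "(\<Sum>U\<in>?I. q + 2 * (real N * real k)) \<le> (\<Sum>U\<in>?I. real (card (Y U)))"
      using X_card True by (intro sum_mono) (auto simp: Y_def side_def intro: less_imp_le)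
    then have "real N * (q + 2 * (real N * real k)) \<le> (\<Sum>U\<in>?I. real (card (Y U)))"
      by (simp add: cI)
    moreover have "real N * (q + 2 * (real N * real k)) = n + 2 * (real N * real N * real k)"
      using N0 by (simp add: q_def field_simps)
    moreover have "2 * (\<Sum>U\<in>?I. real (card (Y U))) \<le> 2 * n + real (4 * k) * (N * (real N - 1))"
      by (rule real_bound) (use y True in \<open>auto simp: Y_def\<close>)
    moreover have "real (4 * k) * (N * (real N - 1)) = 4 * (real N * real N * real k) - 4 * (real N * real k)"
      by (simp add: algebra_simps)
    ultimately show False using Nk k_real by linarith
  next
    case False
    then obtain T where T: "T \<in> ?I" "\<not> y T" by blast
    \<comment> \<open>One outer side is a complement with at least \<open>(11 / 25) * n\<close>
      vertices, and the others have at least \<open>q\<close> each. The total exceeds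
      \<open>n\<close> by a fixed fraction of \<open>n\<close>, which overlaps below
      \<open>11 * k\<close> cannot absorb.\<close>
    have Y_ge: "q \<le> real (card (Y U))" if "U \<in> ?I" for U
      using X_card[OF that] W_card[OF that] n_10 N0
      by (cases "y U") (auto simp: Y_def side_def intro: order.trans[rotated] less_imp_le)
    have "(\<Sum>U\<in>?I - {T}. q) \<le> (\<Sum>U\<in>?I - {T}. real (card (Y U)))"
      using Y_ge by (intro sum_mono) auto
    then have "(real N - 1) * (q) \<le> (\<Sum>U\<in>?I - {T}. real (card (Y U)))"
      using T N by (simp add: cI finite_subsets_of_size of_nat_diff)
    moreover have "(\<Sum>U\<in>?I. real (card (Y U))) = real (card (Y T)) + (\<Sum>U\<in>?I - {T}. real (card (Y U)))"
      using T finite_subsets_of_size by (simp add: sum.remove)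
    moreover have "real (card (Y T)) \<ge> (11 / 25) * n" using W_card T by (auto simp: Y_def side_def)
    moreover have "(real N - 1) * (q) = n - q" using N0 by (simp add: q_def field_simps)
    moreover have "2 * (\<Sum>U\<in>?I. real (card (Y U))) \<le> 2 * n + real (11 * k) * (N * (real N - 1))"
      by (rule real_bound) (use y in \<open>auto simp: Y_def intro: less_imp_le\<close>)
    moreover have "real (11 * k) * (N * (real N - 1)) = 11 * ((real N)\<^sup>2 * real k) - 11 * (real N * real k)"
      by (simp add: algebra_simps power2_eq_square)
    ultimately show False using n_ge n_10 Nk k_real by linarith
  qed
qed

section \<open>The upper bound by a balanced labelling\<close>

lemma residue_class_large:
  assumes "i < N"
  shows "n div N \<le> card {v \<in> {1..n}. (v - 1) mod N = i}"
proof -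
  have "N * j + i + 1 \<le> n" if "j < n div N" for j
  proof -
    have "N * j + N \<le> N * (n div N)" using that mult_le_mono2[of "j + 1" "n div N" N] by simp
    then show ?thesis using assms times_div_less_eq_dividend[of N n] by linarith
  qed
  then have "(\<lambda>j. N * j + i + 1) ` {..<n div N} \<subseteq> {v \<in> {1..n}. (v - 1) mod N = i}"
    using assms by auto
  then have "card ((\<lambda>j. N * j + i + 1) ` {..<n div N}) \<le> card {v \<in> {1..n}. (v - 1) mod N = i}"
    by (rule card_mono[rotated]) simp
  moreover have "card ((\<lambda>j. N * j + i + 1) ` {..<n div N}) = n div N"
    using assms by (subst card_image) (auto simp: inj_on_def)
  ultimately show ?thesis by simp
qed

lemma avoiding_colouring:
  fixes n s k :: nat
  defines "N \<equiv> (2 * s + 1) choose s"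
  assumes k: "k \<ge> 1"
  shows "\<exists>f \<in> colourings n (2 * s + 1). M f n s k \<le> n - n div N"
proof -
  obtain h where h: "bij_betw h {0..<N} (subsets_of_size s)"
    using ex_bij_betw_nat_finite[OF finite_subsets_of_size, of s] by (auto simp: card_subsets_of_size N_def)
  have N: "N > 0" by (simp add: N_def)
  define g where "g v = h ((v - 1) mod N)" for v
  have g: "g v \<in> subsets_of_size s" for v
    using h N by (auto simp: g_def bij_betw_def)
  \<comment> \<open>The union over \<open>e\<close> makes the choice depend on the unordered edge
    only.\<close>
  define f where "f e = (SOME c. c \<in> {1..2 * s + 1} - \<Union>(g ` e))" for e
  have f: "f {u, v} \<in> {1..2 * s + 1} - (g u \<union> g v)" for u v
  proof -
    have "card (g u \<union> g v) \<le> 2 * s"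
      using card_Un_le[of "g u" "g v"] subsets_of_sizeD[OF g] by (simp add: mult_2)
    then have "\<not> {1..2 * s + 1} \<subseteq> g u \<union> g v"
      using card_mono[of "g u \<union> g v" "{1..2 * s + 1}"] subsets_of_sizeD[OF g] by auto
    then have "\<exists>c. c \<in> {1..2 * s + 1} - \<Union>(g ` {u, v})" by auto
    then have "f {u, v} \<in> {1..2 * s + 1} - \<Union>(g ` {u, v})" unfolding f_def by (rule someI_ex)
    then show ?thesis by simp
  qed
  have "f \<in> colourings n (2 * s + 1)"
    unfolding colourings_def edges_def using f by auto
  moreover have "t \<le> n - n div N" if t: "t \<in> orders f n s k" for t
  proof -
    obtain H where H: "t = card (pverts H)" "subgraph (with_proj H) (with_proj (complete_graph n))"
      "k_connected k (with_proj H)" "num_colours f H \<le> s"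
      using t by (auto simp: orders_def)
    have verts: "pverts H \<subseteq> {1..n}" and arcs: "parcs H \<subseteq> parcs (complete_graph n)"
      using H(2) by (auto simp: subgraph_def complete_graph_def)
    \<comment> \<open>The colours of \<open>H\<close> are padded to a full label \<open>S\<close>,
      so that a whole class of vertices carries it.\<close>
    have "f ` edges H \<subseteq> {1..2 * s + 1}" using f by (auto simp: edges_def)
    then obtain S where S: "S \<in> subsets_of_size s" "f ` edges H \<subseteq> S"
      using extend_to_size H(4) unfolding num_colours_def by metis
    have "v \<notin> pverts H" if v: "g v = S" for v
    proof
      assume v_in: "v \<in> pverts H"
      \<comment> \<open>As \<open>k \<ge> 1\<close>, the empty set may be deleted, so
        \<open>H\<close> is connected; it has at least two vertices, so \<open>v\<close> lies on an
        edge. Its colour would avoid \<open>g v = S\<close>.\<close>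
      have conn: "Digraph_Component.connected (with_proj H \<restriction> pverts H)"
        using H(3) k by (auto simp: k_connected_def dest: spec[of _ "{}"])
      have "2 \<le> card (pverts H)" using H(3) k by (simp add: k_connected_def)
      then have "\<not> pverts H \<subseteq> {v}" using card_mono[of "{v}" "pverts H"] by auto
      then obtain w where w: "w \<in> pverts H" "w \<noteq> v" by blast
      obtain e where e: "e \<in> parcs H" "fst e = v \<or> snd e = v"
        by (rule connected_crossing[OF conn, of "{v}" v w])
          (use v_in w in \<open>auto simp: induce_subgraph_def\<close>)
      then obtain x where x: "{v, x} \<in> edges H"
        by (cases e) (force simp: edges_def insert_commute image_iff)
      then show False using S(2) f[of v x] v by blast
    qed
    moreover obtain i where i: "i < N" "h i = S"
      using h S(1) unfolding bij_betw_def by (metis atLeastLessThan_iff imageE)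
    ultimately have "pverts H \<subseteq> {1..n} - {v \<in> {1..n}. (v - 1) mod N = i}"
      using verts by (auto simp: g_def)
    then have "t \<le> card ({1..n} - {v \<in> {1..n}. (v - 1) mod N = i})"
      unfolding H(1) by (intro card_mono) auto
    also have "\<dots> = n - card {v \<in> {1..n}. (v - 1) mod N = i}"
      by (subst card_Diff_subset) auto
    also have "\<dots> \<le> n - n div N" using residue_class_large[OF i(1)] by (intro diff_le_mono2)
    finally show ?thesis .
  qed
  then have "M f n s k \<le> n - n div N"
    unfolding M_def by (intro Max.boundedI) (auto simp: finite_orders)
  ultimately show ?thesis by blast
qed

theorem theorem1p4:
  fixes n s k :: nat and \<epsilon> :: real
  assumes "n \<ge> 1" and "k \<ge> 1" and "s \<ge> 2"
    and "n \<ge> 100 * ((2 * s + 1) choose s)\<^sup>2 * k\<^sup>2"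
    and "\<epsilon> = inverse (real ((2 * s + 1) choose s))"
  shows "(1 - \<epsilon>) * real n - 2 * real ((2 * s + 1) choose s) * real k \<le> real (m n (2 * s + 1) s k)
       \<and> real (m n (2 * s + 1) s k) \<le> (1 - \<epsilon>) * real n + 1"
proof
  let ?N = "(2 * s + 1) choose s"
  have wf: "finite ((\<lambda>f. M f n s k) ` colourings n (2 * s + 1))"
    "(\<lambda>f. M f n s k) ` colourings n (2 * s + 1) \<noteq> {}"
    by (rule m_wf; simp)+
  obtain f where f: "f \<in> colourings n (2 * s + 1)" "m n (2 * s + 1) s k = M f n s k"
    using Min_in[OF wf] unfolding m_def by auto
  obtain t where "t \<in> orders f n s k" "(1 - 1 / ?N) * n - 2 * real ?N * real k \<le> real t"
    using large_order_exists[OF assms(2-4) f(1)] by blast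
  moreover from this have "t \<le> M f n s k" unfolding M_def by (simp add: finite_orders)
  ultimately show "(1 - \<epsilon>) * real n - 2 * real ?N * real k \<le> real (m n (2 * s + 1) s k)"
    using f(2) assms(5) by (simp add: inverse_eq_divide)
  obtain f' where f': "f' \<in> colourings n (2 * s + 1)" "M f' n s k \<le> n - n div ?N"
    using avoiding_colouring[OF assms(2)] by blast
  have "m n (2 * s + 1) s k \<le> M f' n s k" unfolding m_def using wf(1) f'(1) by (intro Min_le) auto
  then have "real (m n (2 * s + 1) s k) \<le> real n - real (n div ?N)"
    using f'(2) div_le_dividend[of n ?N] by linarith
  \<comment> \<open>Rounding down the class size costs at most one vertex, the \<open>+ 1\<close> of
    the upper bound.\<close>
  moreover have "real n / ?N \<le> real (n div ?N) + 1"
  proof -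
    have "?N > 0" by simp
    then have "n \<le> ?N * (n div ?N) + ?N"
      using mult_div_mod_eq[of ?N n] mod_less_divisor[of ?N n] by linarith
    then have "real n \<le> real (?N * (n div ?N) + ?N)" by (simp only: of_nat_le_iff)
    then show ?thesis using \<open>?N > 0\<close> by (simp add: field_simps)
  qed
  ultimately show "real (m n (2 * s + 1) s k) \<le> (1 - \<epsilon>) * real n + 1"
    using assms(5) by (simp add: algebra_simps divide_inverse)
qed

end
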